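(* Let $a>0$, $\lambda>0$, $\mu=\sqrt{\lambda^2+1}$, let $\alpha(t)=(\lambda t,\sinh t,\cosh t)$, $t\in\mathbb{R}$ (a spacelike helix of $\mathbb{L}^3$ of type II with spacelike axis), and let $V(t)=\cosh(at)\,\mathbf{n}(t)+\sinh(at)\,\mathbf{b}(t)$, where $$\mathbf{n}(t)=(0,\sinh t,\cosh t),\qquad \mathbf{b}(t)=\frac1\mu(1,-\lambda\cosh t,-\lambda\sinh t).$$ Then the Björling surface $X=(X_1,X_2,X_3)$ with data $\alpha$ and $V$ is parametrized as follows. If $a\neq1$: $$X_1=\frac{\cosh(au)\sin(av)}{a}+\lambda u,$$ $$X_2=\frac{\sinh u\Big((a^2-1)\cos v+\sinh(au)\big((a\mu+\lambda)\cos v\sin(av)-(a\lambda+\mu)\sin v\cos(av)\big)\Big)}{a^2-1}+\frac{\cosh u\cosh(au)\big((a\mu+\lambda)\sin v\cos(av)-(a\lambda+\mu)\cos v\sin(av)\big)}{a^2-1},$$ $$X_3=\frac{\cosh u\Big((a^2-1)\cos v+\sinh(au)\big((a\mu+\lambda)\cos v\sin(av)-(a\lambda+\mu)\sin v\cos(av)\big)\Big)}{a^2-1}+\frac{\sinh u\cosh(au)\big((a\mu+\lambda)\sin v\cos(av)-(a\lambda+\mu)\cos v\sin(av)\big)}{a^2-1}.$$ If $a=1$: $$X_1=\lambda u+\cosh u\sin v,$$ $$X_2=\tfrac12\Big((\mu-\lambda)(\sinh^2u+\cosh^2u)\sin v\cos v+2\sinh u\cos v-(\mu+\lambda)v\Big),$$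 $$X_3=\cosh u\cos v\big((\mu-\lambda)\sinh u\sin v+1\big).$$
   Context: $\mathbb{L}^3$ is $\mathbb{R}^3$ with the metric $\langle,\rangle=dx^2+dy^2-dz^2$. The Lorentzian cross product is $(x_1,x_2,x_3)\times(y_1,y_2,y_3)=(x_2y_3-x_3y_2,\ x_3y_1-x_1y_3,\ -(x_1y_2-x_2y_1))$, extended complex-bilinearly. A maximal surface is a spacelike surface (induced metric Riemannian) with zero mean curvature everywhere. Björling problem: given a real analytic spacelike curve $\alpha:I\to\mathbb{L}^3$ and a real analytic unit timelike vector field $V$ along $\alpha$ with $\langle V,\alpha'\rangle=0$, find a maximal surface containing $\alpha$ with unit normal $V$ along $\alpha$. Its solution (the Björling surface with data $\alpha,V$, unique with $\alpha$ being the parameter curve $v=0$) is $$X(u,v)=\mathrm{Re}\left(\alpha(z)+i\int_{u_0}^z V(w)\times\alpha'(w)\,dw\right),\qquad z=u+iv,$$ where $u_0\in I$ is fixed and $\alpha(z),V(z)$ are the holomorphic extensions of $\alpha,V$ to a simply-connected domain of $\mathbb{C}$ containing $I\times\{0\}$. Maximality is understood away from points where $X$ fails to be an immersion with nondegenerate induced metric. *)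

theory Defs
  imports "HOL-Complex_Analysis.Complex_Analysis"
begin

definition linner :: "real^3 \<Rightarrow> real^3 \<Rightarrow> real" where
  "linner x y = x$1 * y$1 + x$2 * y$2 - x$3 * y$3"

text \<open>The Lorentzian cross product over an arbitrary commutative ring; the instance
  \<^typ>\<open>complex\<close> is the complex-bilinear extension of the instance \<^typ>\<open>real\<close>.\<close>

definition lcross :: "'a::comm_ring_1^3 \<Rightarrow> 'a^3 \<Rightarrow> 'a^3" where
  "lcross x y = vector [x$2 * y$3 - x$3 * y$2, x$3 * y$1 - x$1 * y$3, - (x$1 * y$2 - x$2 * y$1)]"

definition real_analytic_on :: "(real \<Rightarrow> real^3) \<Rightarrow> real set \<Rightarrow> bool" where
  "real_analytic_on f I \<longleftrightarrow>
     (\<forall>t0\<in>I. \<exists>r>0. \<exists>c :: nat \<Rightarrow> real^3. \<forall>t\<in>I. \<bar>t - t0\<bar> < r \<longrightarrow>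
        (\<lambda>n. (t - t0) ^ n *\<^sub>R c n) sums f t)"

definition bjorling_data :: "real set \<Rightarrow> (real \<Rightarrow> real^3) \<Rightarrow> (real \<Rightarrow> real^3) \<Rightarrow> bool" where
  "bjorling_data I \<alpha> V \<longleftrightarrow>
     open I \<and> is_interval I \<and> I \<noteq> {} \<and> real_analytic_on \<alpha> I \<and> real_analytic_on V I \<and>
     (\<forall>t\<in>I. let \<alpha>' = vector_derivative \<alpha> (at t) in
        linner \<alpha>' \<alpha>' > 0 \<and> linner (V t) (V t) = -1 \<and> linner (V t) \<alpha>' = 0)"

text \<open>A parametrized surface is a map on an open subset of the complex plane, the point
  \<^term>\<open>Complex u v\<close> having the parameters \<^term>\<open>u\<close> and \<^term>\<open>v\<close>.\<close>

definition Du :: "(complex \<Rightarrow> real^3) \<Rightarrow> complex \<Rightarrow> real^3" where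
  "Du X z = frechet_derivative X (at z) 1"

definition Dv :: "(complex \<Rightarrow> real^3) \<Rightarrow> complex \<Rightarrow> real^3" where
  "Dv X z = frechet_derivative X (at z) \<i>"

primrec Ck_on :: "nat \<Rightarrow> complex set \<Rightarrow> (complex \<Rightarrow> real^3) \<Rightarrow> bool" where
  "Ck_on 0 D X \<longleftrightarrow> continuous_on D X"
| "Ck_on (Suc k) D X \<longleftrightarrow> X differentiable_on D \<and> Ck_on k D (Du X) \<and> Ck_on k D (Dv X)"

definition metric_det :: "(complex \<Rightarrow> real^3) \<Rightarrow> complex \<Rightarrow> real" where
  "metric_det X z =
     linner (Du X z) (Du X z) * linner (Dv X z) (Dv X z) - (linner (Du X z) (Dv X z))\<^sup>2"

definition unit_normal :: "(complex \<Rightarrow> real^3) \<Rightarrow> complex \<Rightarrow> real^3" where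
  "unit_normal X z =
     (let n = lcross (Du X z) (Dv X z) in (1 / sqrt \<bar>linner n n\<bar>) *\<^sub>R n)"

text \<open>The leading sign is \<^term>\<open>linner N N\<close> for the timelike unit normal \<^term>\<open>N\<close> of a
  spacelike surface.\<close>

definition mean_curvature :: "(complex \<Rightarrow> real^3) \<Rightarrow> complex \<Rightarrow> real" where
  "mean_curvature X z =
     (let N = unit_normal X z;
          E = linner (Du X z) (Du X z); F = linner (Du X z) (Dv X z); G = linner (Dv X z) (Dv X z);
          e = linner (Du (Du X) z) N; f = linner (Dv (Du X) z) N; g = linner (Dv (Dv X) z) N
      in - (e * G - 2 * f * F + g * E) / (2 * (E * G - F\<^sup>2)))"

text \<open>A point is a singularity, and is exempted, if \<^term>\<open>X\<close> is not an immersion there or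
  the induced metric is degenerate; both are covered by the vanishing of \<^const>\<open>metric_det\<close>.
  At all other points the induced metric has to be positive definite.\<close>

definition maximal_surface :: "complex set \<Rightarrow> (complex \<Rightarrow> real^3) \<Rightarrow> bool" where
  "maximal_surface D X \<longleftrightarrow>
     open D \<and> (\<forall>k. Ck_on k D X) \<and>
     (\<forall>z\<in>D. metric_det X z \<noteq> 0 \<longrightarrow>
        linner (Du X z) (Du X z) > 0 \<and> metric_det X z > 0 \<and> mean_curvature X z = 0)"

definition solves_bjorling_problem ::
    "real set \<Rightarrow> (real \<Rightarrow> real^3) \<Rightarrow> (real \<Rightarrow> real^3) \<Rightarrow> complex set \<Rightarrow> (complex \<Rightarrow> real^3) \<Rightarrow> bool" where
  "solves_bjorling_problem I \<alpha> V D X \<longleftrightarrow>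
     maximal_surface D X \<and>
     (\<forall>t\<in>I. complex_of_real t \<in> D \<and> metric_det X (complex_of_real t) \<noteq> 0 \<and>
        X (complex_of_real t) = \<alpha> t \<and> unit_normal X (complex_of_real t) = V t)"

definition holomorphic_extension ::
    "real set \<Rightarrow> (real \<Rightarrow> real^3) \<Rightarrow> complex set \<Rightarrow> (complex \<Rightarrow> complex^3) \<Rightarrow> bool" where
  "holomorphic_extension I f D F \<longleftrightarrow>
     (\<forall>k. (\<lambda>z. F z $ k) holomorphic_on D) \<and>
     (\<forall>t\<in>I. \<forall>k. F (complex_of_real t) $ k = complex_of_real (f t $ k))"

text \<open>The Bjorling surface, given by its integral formula on \<^term>\<open>D\<close>. For open, simply
  connected \<^term>\<open>D\<close> containing the interval \<^term>\<open>I\<close>, the extensions are unique on \<^term>\<open>D\<close>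
  and the integral does not depend on the path \<^term>\<open>\<gamma>\<close>.\<close>

definition bjorling_surface ::
    "real set \<Rightarrow> (real \<Rightarrow> real^3) \<Rightarrow> (real \<Rightarrow> real^3) \<Rightarrow> real \<Rightarrow> complex set \<Rightarrow> (complex \<Rightarrow> real^3) \<Rightarrow> bool" where
  "bjorling_surface I \<alpha> V u0 D X \<longleftrightarrow>
     (\<exists>\<alpha>c Vc. holomorphic_extension I \<alpha> D \<alpha>c \<and> holomorphic_extension I V D Vc \<and>
        (\<forall>z\<in>D. \<forall>\<gamma>. valid_path \<gamma> \<and> path_image \<gamma> \<subseteq> D \<and>
             pathstart \<gamma> = complex_of_real u0 \<and> pathfinish \<gamma> = z \<longrightarrow>
           X z = (\<chi> k. Re (\<alpha>c z $ k + \<i> * contour_integral \<gamma>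
                    (\<lambda>w. lcross (Vc w) (\<chi> j. deriv (\<lambda>\<zeta>. \<alpha>c \<zeta> $ j) w) $ k)))))"

definition helix :: "real \<Rightarrow> real \<Rightarrow> real^3" where
  "helix lam t = vector [lam * t, sinh t, cosh t]"

definition helix_n :: "real \<Rightarrow> real^3" where
  "helix_n t = vector [0, sinh t, cosh t]"

definition helix_b :: "real \<Rightarrow> real \<Rightarrow> real \<Rightarrow> real^3" where
  "helix_b lam mu t = (1 / mu) *\<^sub>R vector [1, - lam * cosh t, - lam * sinh t]"

definition helix_field :: "real \<Rightarrow> real \<Rightarrow> real \<Rightarrow> real \<Rightarrow> real^3" where
  "helix_field a lam mu t = cosh (a * t) *\<^sub>R helix_n t + sinh (a * t) *\<^sub>R helix_b lam mu t"

end

(* On the parameter axis the curve \<Phi> = \<alpha>' + i V \<times> \<alpha>' is null for the complexified Lorentzian form,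
   because V is unit and orthogonal to \<alpha>'; by analytic continuation it is null on all of the domain.
   The real part of a primitive of \<Phi> is therefore a conformal harmonic map, hence maximal, and its
   tangent vectors \<alpha>' and - V \<times> \<alpha>' on the axis span the orthogonal complement of V. For the helix
   V \<times> \<alpha>' is a combination of products of hyperbolic functions with frequencies a and 1, whose
   primitive is elementary, with the resonance a = 1 as a separate case. *)

theory Submission
  imports Defs
begin

no_notation fps_nth (infixl "$" 75)

section \<open>Lorentzian vector algebra\<close>

text \<open>\<open>linner\<close> exists over the reals only. Nullity concerns the complex-bilinear
  (not Hermitian) extension, so the form is taken over any commutative ring, as for
  \<open>lcross\<close>.\<close>

definition lprod :: "'a::comm_ring_1^3 \<Rightarrow> 'a^3 \<Rightarrow> 'a" where
  "lprod x y = x$1 * y$1 + x$2 * y$2 - x$3 * y$3"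

lemma linner_eq_lprod: "linner = lprod"
  by (simp add: fun_eq_iff linner_def lprod_def)

lemma vec3_eq_iff: "x = y \<longleftrightarrow> x$1 = y$1 \<and> x$2 = y$2 \<and> x$3 = y$3" for x y :: "'a^3"
  by (simp add: vec_eq_iff forall_3)

lemma lcross_nth [simp]:
  "lcross x y $ 1 = x$2 * y$3 - x$3 * y$2"
  "lcross x y $ 2 = x$3 * y$1 - x$1 * y$3"
  "lcross x y $ 3 = - (x$1 * y$2 - x$2 * y$1)"
  by (simp_all add: lcross_def)

text \<open>Lagrange's identity, with the sign opposite to the Euclidean one. For x unit timelike
  and orthogonal to y it makes x cross y have the same square as y.\<close>

lemma lprod_lcross_self: "lprod (lcross x y) (lcross x y) = (lprod x y)\<^sup>2 - lprod x x * lprod y y"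
  by (simp add: lprod_def power2_eq_square algebra_simps)

lemma lprod_lcross_right: "lprod y (lcross x y) = 0"
  by (simp add: lprod_def algebra_simps)

text \<open>Triple product expansion. It serves to compute the normal on the axis, where the tangent
  vectors are y = alpha' and -(V x alpha') with x = V.\<close>

lemma lcross_lcross_neg: "lcross y (- lcross x y) = lprod y y *s x - lprod x y *s y"
  by (simp add: vec3_eq_iff lprod_def algebra_simps)

lemma lprod_minus [simp]: "lprod (- x) y = - lprod x y" "lprod x (- y) = - lprod x y"
  by (simp_all add: lprod_def)

lemma lprod_scaleR [simp]:
  "lprod (c *\<^sub>R x) y = c * lprod x y" "lprod x (c *\<^sub>R y) = c * lprod x y"
  for x y :: "real^3"
  by (simp_all add: lprod_def algebra_simps)

text \<open>The negative directions of the Lorentzian metric span only one dimension, so two orthogonal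
  vectors of equal square cannot both be timelike.\<close>

lemma lprod_orthogonal_nonneg:
  fixes x y :: "real^3"
  assumes "lprod x y = 0" "lprod x x = lprod y y"
  shows "lprod x x \<ge> 0"
proof (rule ccontr)
  assume "\<not> ?thesis"
  then have x: "(x$1)\<^sup>2 + (x$2)\<^sup>2 < (x$3)\<^sup>2" and y: "(y$1)\<^sup>2 + (y$2)\<^sup>2 < (y$3)\<^sup>2"
    using assms(2) by (simp_all add: lprod_def power2_eq_square)
  have "(x$3 * y$3)\<^sup>2 = (x$1 * y$1 + x$2 * y$2)\<^sup>2"
    using assms(1) by (simp add: lprod_def)
  \<comment> \<open>Cauchy-Schwarz in the first two coordinates; the deficit is the square of the 2
    by 2 determinant.\<close>
  also have "\<dots> \<le> ((x$1)\<^sup>2 + (x$2)\<^sup>2) * ((y$1)\<^sup>2 + (y$2)\<^sup>2)"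
    using zero_le_power2[of "x$1 * y$2 - x$2 * y$1"] by (simp add: power2_eq_square algebra_simps)
  also have "\<dots> < (x$3)\<^sup>2 * (y$3)\<^sup>2"
    using x y by (intro mult_strict_mono) (auto simp: not_sum_power2_lt_zero)
  finally show False by (simp add: power_mult_distrib)
qed

section \<open>Real parts of holomorphic curves\<close>

lemma has_derivative_vec_lambda:
  fixes f :: "'a::real_normed_vector \<Rightarrow> 'n::finite \<Rightarrow> real"
  assumes "\<And>k. ((\<lambda>x. f x k) has_derivative (\<lambda>h. f' h k)) (at x within S)"
  shows "((\<lambda>x. \<chi> k. f x k) has_derivative (\<lambda>h. \<chi> k. f' h k)) (at x within S)"
  using assms by (subst has_derivative_componentwise_within) (auto simp: Basis_vec_def inner_axis)

text \<open>Componentwise complex derivative, in the same form in which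
  \<open>bjorling_surface\<close> writes the derivative of the extended curve.\<close>

definition vderiv :: "(complex \<Rightarrow> complex^'n) \<Rightarrow> complex \<Rightarrow> complex^'n" where
  "vderiv F z = (\<chi> j. deriv (\<lambda>\<zeta>. F \<zeta> $ j) z)"

lemma vderiv_nth [simp]: "vderiv F z $ k = deriv (\<lambda>\<zeta>. F \<zeta> $ k) z"
  by (simp add: vderiv_def)

lemma vderiv_holomorphic:
  assumes "open D" "\<And>k. (\<lambda>z. F z $ k) holomorphic_on D"
  shows "(\<lambda>z. vderiv F z $ k) holomorphic_on D"
  using holomorphic_deriv[OF assms(2,1)] by simp

context
  fixes D :: "complex set" and F :: "complex \<Rightarrow> complex^3" and X :: "complex \<Rightarrow> real^3"
  assumes D: "open D"
    and hol: "\<And>k. (\<lambda>z. F z $ k) holomorphic_on D"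
    and X: "\<And>z. z \<in> D \<Longrightarrow> X z = (\<chi> k. Re (F z $ k))"
begin

lemma Re_curve_has_derivative:
  assumes z: "z \<in> D"
  shows "(X has_derivative (\<lambda>h. \<chi> k. Re (vderiv F z $ k * h))) (at z)"
proof -
  have "((\<lambda>z. F z $ k) has_derivative (\<lambda>h. vderiv F z $ k * h)) (at z)" for k
    using holomorphic_derivI[OF hol D z] by (simp add: has_field_derivative_def)
  then have "((\<lambda>z. \<chi> k. Re (F z $ k)) has_derivative (\<lambda>h. \<chi> k. Re (vderiv F z $ k * h))) (at z)"
    by (intro has_derivative_vec_lambda has_derivative_Re)
  \<comment> \<open>\<open>X\<close> is tied to \<open>F\<close> on \<open>D\<close> only; agreement
    on an open neighbourhood of z is enough for the derivative.\<close>
  then show ?thesis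
    by (rule has_derivative_transform_within_open[OF _ D z]) (simp add: X)
qed

lemma Du_Re_curve: "z \<in> D \<Longrightarrow> Du X z = (\<chi> k. Re (vderiv F z $ k))"
  by (simp add: Du_def frechet_derivative_at[OF Re_curve_has_derivative, symmetric])

text \<open>The derivative is complex linear, so direction i multiplies F' by i. Leaving i inside
  \<open>Re\<close> shows \<open>Dv X\<close> again as the real part of a holomorphic curve, which
  allows iteration.\<close>

lemma Dv_Re_curve: "z \<in> D \<Longrightarrow> Dv X z = (\<chi> k. Re (\<i> * vderiv F z $ k))"
  by (simp add: Dv_def frechet_derivative_at[OF Re_curve_has_derivative, symmetric])

end

text \<open>The class of real parts of holomorphic curves is closed under both partial derivatives:
  F' yields \<open>Du X\<close> and i F' yields \<open>Dv X\<close>. Hence the induction has to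
  range over all \<open>F\<close> and \<open>X\<close>.\<close>

lemma Ck_on_Re_curve:
  assumes "open D" "\<And>k. (\<lambda>z. F z $ k) holomorphic_on D" "\<And>z. z \<in> D \<Longrightarrow> X z = (\<chi> k. Re (F z $ k))"
  shows "Ck_on n D X"
  using assms(2,3)
proof (induction n arbitrary: F X)
  case 0
  have "X differentiable_on D"
    using Re_curve_has_derivative[OF \<open>open D\<close> 0]
    by (meson differentiable_def differentiable_at_imp_differentiable_on)
  then show ?case by (simp add: differentiable_imp_continuous_on)
next
  case (Suc n)
  note S = \<open>open D\<close> Suc.prems
  have "X differentiable_on D"
    using Re_curve_has_derivative[OF S]
    by (meson differentiable_def differentiable_at_imp_differentiable_on)
  moreover have "Ck_on n D (Du X)"
    using Du_Re_curve[OF S] vderiv_holomorphic[OF S(1,2)] by (intro Suc.IH[of "vderiv F"])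
  moreover have "Ck_on n D (Dv X)"
  proof (rule Suc.IH[of "\<lambda>z. \<chi> k. \<i> * vderiv F z $ k"])
    show "(\<lambda>z. (\<chi> k. \<i> * vderiv F z $ k) $ k) holomorphic_on D" for k
      using vderiv_holomorphic[OF S(1,2), of k] by (auto intro!: holomorphic_intros)
    show "Dv X z = (\<chi> k. Re ((\<chi> k. \<i> * vderiv F z $ k) $ k))" if "z \<in> D" for z
      using Dv_Re_curve[OF S that] by simp
  qed
  ultimately show ?case by simp
qed

text \<open>A null curve makes the coordinates isothermal: \<open>E = G\<close> and \<open>F = 0\<close>. The numerator of the
  mean curvature then reduces to the Laplacian, which vanishes on real parts.\<close>

lemma maximal_surface_Re_null_curve:
  assumes D: "open D" and hol: "\<And>k. (\<lambda>z. F z $ k) holomorphic_on D"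
    and X: "\<And>z. z \<in> D \<Longrightarrow> X z = (\<chi> k. Re (F z $ k))"
    and null: "\<And>z. z \<in> D \<Longrightarrow> lprod (vderiv F z) (vderiv F z) = 0"
  shows "maximal_surface D X"
  unfolding maximal_surface_def
proof (intro conjI allI ballI impI)
  note S = D hol X
  show "open D" by (rule D)
  show "Ck_on n D X" for n by (rule Ck_on_Re_curve[OF S])
  fix z assume z: "z \<in> D" and nd: "metric_det X z \<noteq> 0"
  let ?u = "Du X z" and ?v = "Dv X z"
  \<comment> \<open>Since F' = Du X - i Dv X, its complex square is E - G - 2 i F; the real and
    imaginary parts are read off in turn.\<close>
  have "lprod ?u ?u - lprod ?v ?v = Re (lprod (vderiv F z) (vderiv F z))"
    by (simp add: Du_Re_curve[OF S z] Dv_Re_curve[OF S z] lprod_def)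
  then have EG: "lprod ?u ?u = lprod ?v ?v" using null[OF z] by simp
  have "2 * lprod ?u ?v = - Im (lprod (vderiv F z) (vderiv F z))"
    by (simp add: Du_Re_curve[OF S z] Dv_Re_curve[OF S z] lprod_def)
  then have F0: "lprod ?u ?v = 0" using null[OF z] by simp
  have det: "metric_det X z = (lprod ?u ?u)\<^sup>2"
    using EG F0 by (simp add: metric_det_def linner_eq_lprod power2_eq_square)
  have "lprod ?u ?u \<ge> 0" by (rule lprod_orthogonal_nonneg[OF F0 EG])
  moreover have "lprod ?u ?u \<noteq> 0" using nd det by auto
  ultimately have E: "lprod ?u ?u > 0" by simp
  then show "0 < linner ?u ?u" by (simp add: linner_eq_lprod)
  show "0 < metric_det X z" using E det by simp
  note S' = D vderiv_holomorphic[OF S(1,2)] Du_Re_curve[OF S]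
  have hol': "(\<lambda>z. (\<chi> k. \<i> * vderiv F z $ k) $ k) holomorphic_on D" for k
    using vderiv_holomorphic[OF S(1,2), of k] by (auto intro!: holomorphic_intros)
  have X': "Dv X z = (\<chi> k. Re ((\<chi> k. \<i> * vderiv F z $ k) $ k))" if "z \<in> D" for z
    using Dv_Re_curve[OF S that] by simp
  have fd: "(\<lambda>z. vderiv F z $ k) field_differentiable at z" for k
    using vderiv_holomorphic[OF S(1,2)] D z by (metis holomorphic_on_imp_differentiable_at)
  \<comment> \<open>The second v-derivative is the real part of i * i * F'' = - F'', the negative of
    the second u-derivative: X is harmonic.\<close>
  have "vderiv (\<lambda>z. \<chi> k. \<i> * vderiv F z $ k) z = (\<chi> k. \<i> * vderiv (vderiv F) z $ k)"
    using deriv_cmult[OF fd] by (simp add: vec_eq_iff)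
  then have laplace: "Dv (Dv X) z = - Du (Du X) z"
    by (simp add: Dv_Re_curve[OF D hol' X' z] Du_Re_curve[OF S' z] vec_eq_iff del: vderiv_nth)
  let ?N = "unit_normal X z"
  have "linner (Dv (Dv X) z) ?N = - linner (Du (Du X) z) ?N"
    by (simp add: laplace linner_def)
  then show "mean_curvature X z = 0"
    using EG F0 by (simp add: mean_curvature_def Let_def linner_eq_lprod)
qed

section \<open>Derivatives and power series of curves with a holomorphic extension\<close>

lemma holomorphic_extension_has_vector_derivative:
  assumes ext: "holomorphic_extension I f D F"
    and I: "open I" and D: "open D" and ID: "of_real ` I \<subseteq> D" and t: "t \<in> I"
  shows "(f has_vector_derivative (\<chi> k. Re (vderiv F (of_real t) $ k))) (at t)"
    and "vderiv F (of_real t) $ k = of_real (vector_derivative f (at t) $ k)"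
proof -
  define d where "d = vderiv F (of_real t)"
  have tD: "of_real t \<in> D" using ID t by auto
  have d: "((\<lambda>x. f x $ k) has_field_derivative Re (d $ k)) (at t) \<and> Im (d $ k) = 0" for k
  proof -
    have "(\<lambda>z. F z $ k) holomorphic_on D"
      using ext by (simp add: holomorphic_extension_def)
    then have "((\<lambda>x. F (of_real x) $ k) has_vector_derivative d $ k) (at t)"
      unfolding d_def using tD D
      by (auto intro!: has_vector_derivative_real_field holomorphic_derivI)
    moreover have "F (of_real x) $ k = of_real (f x $ k)" if "x \<in> I" for x
      using ext that by (simp add: holomorphic_extension_def)
    ultimately have "((\<lambda>x. complex_of_real (f x $ k)) has_vector_derivative d $ k) (at t)"
      using I t by (auto intro: has_vector_derivative_transform_within_open)
    \<comment> \<open>The limit is taken along the real axis, where the imaginary part is constantly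
      0, so its derivative vanishes.\<close>
    then show ?thesis
      using DERIV_unique[OF DERIV_const] by (fastforce simp: has_vector_derivative_complex_iff)
  qed
  have "((\<lambda>x. \<chi> k. f x $ k) has_derivative (\<lambda>h. \<chi> k. Re (d $ k) * h)) (at t)"
    using d by (intro has_derivative_vec_lambda) (simp add: has_field_derivative_def)
  moreover have "(\<lambda>h. \<chi> k. Re (d $ k) * h) = (\<lambda>h. h *\<^sub>R (\<chi> k. Re (d $ k)))"
    by (auto simp: vec_eq_iff)
  ultimately show deriv: "(f has_vector_derivative (\<chi> k. Re (vderiv F (of_real t) $ k))) (at t)"
    unfolding d_def by (simp add: has_vector_derivative_def)
  show "vderiv F (of_real t) $ k = of_real (vector_derivative f (at t) $ k)"
    using d[of k] unfolding d_def by (simp add: vector_derivative_at[OF deriv] complex_eq_iff)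
qed

text \<open>The Taylor series of an entire function at a real centre converges at every real point.
  Real parts of its coefficients give the real vectors demanded, and since convergence is global the
  radius 1 is an arbitrary choice.\<close>

lemma real_analytic_on_entire_extension:
  assumes "holomorphic_extension UNIV f UNIV F"
  shows "real_analytic_on f UNIV"
proof -
  define c where "c t0 n k = (deriv ^^ n) (\<lambda>z. F z $ k) (complex_of_real t0) / fact n" for t0 n k
  have "(\<lambda>n. (t - t0) ^ n *\<^sub>R (\<chi> k. Re (c t0 n k))) sums f t" for t0 t
  proof -
    have "(\<lambda>n. (t - t0) ^ n * Re (c t0 n k)) sums (f t $ k)" for k
    proof -
      \<comment> \<open>The ball around t0 is chosen one larger than the distance to t, so that t
        lies inside.\<close>
      have hol: "(\<lambda>z. F z $ k) holomorphic_on ball (of_real t0) (dist (of_real t0) (complex_of_real t) + 1)"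
        using assms by (auto simp: holomorphic_extension_def intro: holomorphic_on_subset)
      have "(\<lambda>n. c t0 n k * (of_real t - of_real t0) ^ n) sums (F (of_real t) $ k)"
        unfolding c_def using holomorphic_power_series[OF hol, of "of_real t"] by simp
      moreover have "F (of_real t) $ k = of_real (f t $ k)"
        using assms by (simp add: holomorphic_extension_def)
      ultimately have "(\<lambda>n. Re (c t0 n k * of_real ((t - t0) ^ n))) sums (f t $ k)"
        by (simp add: sums_complex_iff)
      then show ?thesis by (simp add: mult.commute del: of_real_power)
    qed
    then show ?thesis
      unfolding sums_def by (intro vec_tendstoI) (simp add: sum_component)
  qed
  then have sums: "\<forall>t\<in>UNIV. \<bar>t - t0\<bar> < 1 \<longrightarrow> (\<lambda>n. (t - t0) ^ n *\<^sub>R (\<chi> k. Re (c t0 n k))) sums f t" for t0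
    by simp
  have "\<exists>r>0. \<exists>d. \<forall>t\<in>UNIV. \<bar>t - t0\<bar> < r \<longrightarrow> (\<lambda>n. (t - t0) ^ n *\<^sub>R d n) sums f t" for t0
  proof (rule exI[where x = 1], rule conjI[OF zero_less_one], rule exI[where x = "\<lambda>n. \<chi> k. Re (c t0 n k)"])
    show "\<forall>t\<in>UNIV. \<bar>t - t0\<bar> < 1 \<longrightarrow> (\<lambda>n. (t - t0) ^ n *\<^sub>R (\<chi> k. Re (c t0 n k))) sums f t"
      by (rule sums)
  qed
  then show ?thesis
    by (simp add: real_analytic_on_def)
qed

section \<open>The Bjorling formula\<close>

text \<open>A global primitive \<open>W\<close> of V x alpha' makes the integral path independent.
  As \<open>W\<close> is real on \<open>I\<close>, it differs from the integral started at any u0 in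
  \<open>I\<close> by a real vector, which becomes imaginary under the factor i and leaves the real
  part unchanged.\<close>

locale bjorling_extension =
  fixes I :: "real set" and \<alpha> V :: "real \<Rightarrow> real^3"
    and D :: "complex set" and \<alpha>c Vc W :: "complex \<Rightarrow> complex^3"
  assumes data: "bjorling_data I \<alpha> V"
    and D: "open D" "connected D" and ID: "of_real ` I \<subseteq> D"
    and ext: "holomorphic_extension I \<alpha> D \<alpha>c" "holomorphic_extension I V D Vc"
    and primitive: "\<And>z k. z \<in> D \<Longrightarrow>
      ((\<lambda>z. W z $ k) has_field_derivative lcross (Vc z) (vderiv \<alpha>c z) $ k) (at z)"
    and W_real: "\<And>t k. t \<in> I \<Longrightarrow> W (of_real t) $ k \<in> \<real>"
begin

text \<open>The holomorphic null curve whose real part is the surface.\<close>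

definition weierstrass_curve :: "complex \<Rightarrow> complex^3" where
  "weierstrass_curve z = (\<chi> k. \<alpha>c z $ k + \<i> * W z $ k)"

lemma open_I: "open I" and I_nonempty: "I \<noteq> {}"
  using data by (simp_all add: bjorling_data_def)

section \<open>Identities carried from the interval to the domain\<close>

lemma holomorphic_eqI:
  assumes "f holomorphic_on D" "g holomorphic_on D" "\<And>t. t \<in> I \<Longrightarrow> f (of_real t) = g (of_real t)" "z \<in> D"
  shows "f z = g z"
proof -
  obtain t where t: "t \<in> I" using I_nonempty by auto
  have "\<forall>\<^sub>F y in at t. complex_of_real y \<noteq> complex_of_real t"
    by (simp add: eventually_at_filter)
  \<comment> \<open>In an open subset of the line each point is a limit point; the continuous
    embedding, which does not take the value at t elsewhere, carries this into the plane, as the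
    identity theorem requires.\<close>
  then have lim: "complex_of_real t islimpt of_real ` I"
    using open_imp_islimpt[OF open_I t] by (intro islimpt_isCont_image) simp_all
  have hol: "(\<lambda>z. f z - g z) holomorphic_on D"
    using assms(1,2) by (rule holomorphic_on_diff)
  have "f z - g z = 0"
  proof (rule analytic_continuation[OF hol D ID _ lim _ assms(4)])
    show "complex_of_real t \<in> D" using ID t by auto
    show "f w - g w = 0" if "w \<in> of_real ` I" for w using that assms(3) by auto
  qed
  then show ?thesis by simp
qed

lemma holomorphic_extension_unique:
  assumes "holomorphic_extension I f D F" "holomorphic_extension I f D G" "z \<in> D"
  shows "F z = G z"
  unfolding vec_eq_iff
proof
  show "F z $ k = G z $ k" for k
    by (rule holomorphic_eqI[of "\<lambda>z. F z $ k" "\<lambda>z. G z $ k"])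
      (use assms in \<open>simp_all add: holomorphic_extension_def\<close>)
qed

lemma holomorphic_on_D [holomorphic_intros]:
  "(\<lambda>z. \<alpha>c z $ k) holomorphic_on D" "(\<lambda>z. Vc z $ k) holomorphic_on D" "(\<lambda>z. W z $ k) holomorphic_on D"
proof -
  show "(\<lambda>z. \<alpha>c z $ k) holomorphic_on D" "(\<lambda>z. Vc z $ k) holomorphic_on D"
    using ext by (simp_all add: holomorphic_extension_def)
  show "(\<lambda>z. W z $ k) holomorphic_on D"
    using primitive D(1) holomorphic_on_open by blast
qed

lemma vderiv_\<alpha>c_holomorphic [holomorphic_intros]: "(\<lambda>z. vderiv \<alpha>c z $ k) holomorphic_on D"
  by (rule vderiv_holomorphic[OF D(1) holomorphic_on_D(1)])

lemma ext_of_real: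
  assumes "t \<in> I"
  shows "\<alpha>c (of_real t) $ k = of_real (\<alpha> t $ k)" "Vc (of_real t) $ k = of_real (V t $ k)"
    "vderiv \<alpha>c (of_real t) $ k = of_real (vector_derivative \<alpha> (at t) $ k)"
  using ext assms holomorphic_extension_has_vector_derivative(2)[OF ext(1) open_I D(1) ID assms]
  by (simp_all add: holomorphic_extension_def)

lemma data_at:
  assumes "t \<in> I"
  shows "lprod (vector_derivative \<alpha> (at t)) (vector_derivative \<alpha> (at t)) > 0"
    "lprod (V t) (V t) = -1" "lprod (V t) (vector_derivative \<alpha> (at t)) = 0"
  using data assms by (auto simp: bjorling_data_def Let_def linner_eq_lprod)

text \<open>Both sides are holomorphic, being polynomial in the components, and on the axis they are
  the pointwise conditions of \<open>bjorling_data\<close>.\<close>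

lemma lprod_Vc:
  assumes z: "z \<in> D"
  shows "lprod (Vc z) (Vc z) = -1" and "lprod (Vc z) (vderiv \<alpha>c z) = 0"
proof -
  have hol: "(\<lambda>z. lprod (Vc z) (Vc z)) holomorphic_on D" "(\<lambda>z. lprod (Vc z) (vderiv \<alpha>c z)) holomorphic_on D"
    unfolding lprod_def by (intro holomorphic_intros)+
  show "lprod (Vc z) (Vc z) = -1"
  proof (rule holomorphic_eqI[OF hol(1) holomorphic_on_const _ z])
    fix t assume t: "t \<in> I"
    have "lprod (Vc (of_real t)) (Vc (of_real t)) = of_real (lprod (V t) (V t))"
      by (simp add: lprod_def ext_of_real[OF t])
    then show "lprod (Vc (of_real t)) (Vc (of_real t)) = -1"
      by (simp add: data_at[OF t])
  qed
  show "lprod (Vc z) (vderiv \<alpha>c z) = 0"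
  proof (rule holomorphic_eqI[OF hol(2) holomorphic_on_const _ z])
    fix t assume t: "t \<in> I"
    have "lprod (Vc (of_real t)) (vderiv \<alpha>c (of_real t)) = of_real (lprod (V t) (vector_derivative \<alpha> (at t)))"
      by (simp add: lprod_def ext_of_real[OF t] del: vderiv_nth)
    then show "lprod (Vc (of_real t)) (vderiv \<alpha>c (of_real t)) = 0"
      by (simp add: data_at[OF t])
  qed
qed

section \<open>The null curve and its real part\<close>

lemma weierstrass_curve_holomorphic: "(\<lambda>z. weierstrass_curve z $ k) holomorphic_on D"
  unfolding weierstrass_curve_def vec_lambda_beta by (intro holomorphic_intros)

lemma vderiv_weierstrass_curve:
  assumes z: "z \<in> D"
  shows "vderiv weierstrass_curve z = vderiv \<alpha>c z + \<i> *s lcross (Vc z) (vderiv \<alpha>c z)"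
proof -
  have "((\<lambda>z. \<alpha>c z $ k + \<i> * W z $ k) has_field_derivative
      vderiv \<alpha>c z $ k + \<i> * lcross (Vc z) (vderiv \<alpha>c z) $ k) (at z)" for k
    using holomorphic_derivI[OF holomorphic_on_D(1) D(1) z] primitive[OF z]
    by (intro DERIV_add DERIV_cmult) simp_all
  then show ?thesis
    by (simp add: vec_eq_iff weierstrass_curve_def DERIV_imp_deriv del: lcross_nth)
qed

text \<open>With a = alpha' and w = V x a, the square of a + i w is (a,a) - (w,w) + 2 i (a,w).
  Lagrange's identity and \<open>lprod_Vc\<close> give (w,w) = (a,a), and w is orthogonal to
  a.\<close>

lemma weierstrass_curve_null:
  assumes z: "z \<in> D"
  shows "lprod (vderiv weierstrass_curve z) (vderiv weierstrass_curve z) = 0"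
proof -
  let ?a = "vderiv \<alpha>c z" and ?w = "lcross (Vc z) (vderiv \<alpha>c z)"
  have "lprod (?a + \<i> *s ?w) (?a + \<i> *s ?w) = lprod ?a ?a - lprod ?w ?w + 2 * \<i> * lprod ?a ?w"
    by (simp add: lprod_def algebra_simps del: lcross_nth vderiv_nth)
  also have "\<dots> = 0"
    using lprod_lcross_self[of "Vc z" ?a] by (simp add: lprod_lcross_right lprod_Vc[OF z])
  finally show ?thesis by (simp add: vderiv_weierstrass_curve[OF z])
qed

lemma solves_bjorling_problem_Re_curve:
  assumes X: "\<And>z. z \<in> D \<Longrightarrow> X z = (\<chi> k. Re (weierstrass_curve z $ k))"
  shows "solves_bjorling_problem I \<alpha> V D X"
  unfolding solves_bjorling_problem_def
proof (intro conjI ballI)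
  note S = D(1) weierstrass_curve_holomorphic X
  show "maximal_surface D X"
    by (rule maximal_surface_Re_null_curve[OF S weierstrass_curve_null])
  fix t assume t: "t \<in> I"
  show tD: "of_real t \<in> D" using ID t by auto
  show "X (of_real t) = \<alpha> t"
    using W_real[OF t] by (auto simp: X[OF tD] weierstrass_curve_def ext_of_real[OF t] vec_eq_iff
        complex_is_Real_iff)
  let ?a = "vector_derivative \<alpha> (at t)"
  let ?w = "lcross (V t) ?a"
  have "vderiv weierstrass_curve (of_real t) $ k = Complex (?a $ k) (?w $ k)" for k
    using exhaust_3[of k]
    by (auto simp: vderiv_weierstrass_curve[OF tD] ext_of_real[OF t] complex_eq_iff simp del: vderiv_nth)
  \<comment> \<open>The tangent vectors are the real part and minus the imaginary part of the
    complex derivative.\<close>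
  then have u: "Du X (of_real t) = ?a" and v: "Dv X (of_real t) = - ?w"
    by (simp_all add: Du_Re_curve[OF S tD] Dv_Re_curve[OF S tD] vec_eq_iff del: vderiv_nth)
  have "lprod ?w ?w = lprod ?a ?a"
    by (simp add: lprod_lcross_self data_at[OF t])
  then have "metric_det X (of_real t) = (lprod ?a ?a)\<^sup>2 - (lprod ?a ?w)\<^sup>2"
    by (simp add: metric_det_def linner_eq_lprod u v power2_eq_square)
  then show "metric_det X (of_real t) \<noteq> 0"
    using data_at(1)[OF t] by (simp add: lprod_lcross_right)
  \<comment> \<open>The factor (a,a) is positive, so normalizing gives \<open>V t\<close> itself and
    not its negative.\<close>
  have "lcross ?a (- ?w) = lprod ?a ?a *\<^sub>R V t"
    by (simp add: lcross_lcross_neg data_at[OF t] vec_eq_iff)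
  then show "unit_normal X (of_real t) = V t"
    using data_at(1)[OF t] by (simp add: unit_normal_def u v linner_eq_lprod data_at(2)[OF t] Let_def abs_mult)
qed

text \<open>\<open>bjorling_surface\<close> speaks of some extensions and of every path, so the
  integral is evaluated first for arbitrary ones; uniqueness of the extensions then leads back to
  the fixed primitive.\<close>

lemma bjorling_surface_iff:
  assumes u0: "u0 \<in> I"
  shows "bjorling_surface I \<alpha> V u0 D X \<longleftrightarrow> (\<forall>z\<in>D. X z = (\<chi> k. Re (weierstrass_curve z $ k)))"
proof -
  have u0D: "of_real u0 \<in> D" using u0 ID by auto
  have formula: "(\<chi> k. Re (\<alpha>c' z $ k + \<i> * contour_integral \<gamma>
        (\<lambda>w. lcross (Vc' w) (\<chi> j. deriv (\<lambda>\<zeta>. \<alpha>c' \<zeta> $ j) w) $ k)))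
      = (\<chi> k. Re (weierstrass_curve z $ k))"
    if e: "holomorphic_extension I \<alpha> D \<alpha>c'" "holomorphic_extension I V D Vc'" and z: "z \<in> D"
      and \<gamma>: "valid_path \<gamma>" "path_image \<gamma> \<subseteq> D" "pathstart \<gamma> = of_real u0" "pathfinish \<gamma> = z"
    for \<alpha>c' Vc' z \<gamma>
  proof -
    note \<alpha>_eq = holomorphic_extension_unique[OF e(1) ext(1)] and V_eq = holomorphic_extension_unique[OF e(2) ext(2)]
    have "vderiv \<alpha>c' w = vderiv \<alpha>c w" if "w \<in> D" for w
      unfolding vderiv_def vec_eq_iff vec_lambda_beta
      using \<alpha>_eq D(1) that
      by (intro allI deriv_cong_ev) (auto simp: eventually_nhds)
    then have "((\<lambda>z. W z $ k) has_field_derivative lcross (Vc' w) (vderiv \<alpha>c' w) $ k) (at w within D)"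
      if "w \<in> D" for w k
      using primitive[OF that, of k] V_eq that by (simp add: has_field_derivative_at_within)
    from contour_integral_primitive[OF this \<gamma>(1,2)]
    have "contour_integral \<gamma> (\<lambda>w. lcross (Vc' w) (vderiv \<alpha>c' w) $ k) = W z $ k - W (of_real u0) $ k" for k
      using \<gamma> by (simp add: contour_integral_unique)
    \<comment> \<open>The value of \<open>W\<close> at u0 is real, so i times it has real part
      0.\<close>
    then show ?thesis
      using W_real[OF u0] \<alpha>_eq[OF z]
      by (simp add: vderiv_def vec_eq_iff weierstrass_curve_def complex_is_Real_iff)
  qed
  show ?thesis
  proof
    assume "bjorling_surface I \<alpha> V u0 D X"
    then obtain \<alpha>c' Vc' where e: "holomorphic_extension I \<alpha> D \<alpha>c'" "holomorphic_extension I V D Vc'"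
      and X: "\<And>z \<gamma>. \<lbrakk>z \<in> D; valid_path \<gamma>; path_image \<gamma> \<subseteq> D; pathstart \<gamma> = of_real u0; pathfinish \<gamma> = z\<rbrakk> \<Longrightarrow>
        X z = (\<chi> k. Re (\<alpha>c' z $ k + \<i> * contour_integral \<gamma>
          (\<lambda>w. lcross (Vc' w) (\<chi> j. deriv (\<lambda>\<zeta>. \<alpha>c' \<zeta> $ j) w) $ k)))"
      unfolding bjorling_surface_def by blast
    show "\<forall>z\<in>D. X z = (\<chi> k. Re (weierstrass_curve z $ k))"
    proof
      fix z assume z: "z \<in> D"
      \<comment> \<open>The defining condition determines X z only through a path from u0 to z;
        connectedness of \<open>D\<close> supplies a polynomial one.\<close>
      obtain \<gamma> where "polynomial_function \<gamma>" and \<gamma>: "path_image \<gamma> \<subseteq> D" "pathstart \<gamma> = of_real u0" "pathfinish \<gamma> = z"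
        using connected_open_polynomial_connected[OF D u0D z] by blast
      then have "valid_path \<gamma>" by (simp add: valid_path_polynomial_function)
      with X[OF z _ \<gamma>] formula[OF e z _ \<gamma>]
      show "X z = (\<chi> k. Re (weierstrass_curve z $ k))" by simp
    qed
  next
    assume "\<forall>z\<in>D. X z = (\<chi> k. Re (weierstrass_curve z $ k))"
    then show "bjorling_surface I \<alpha> V u0 D X"
      unfolding bjorling_surface_def
      using ext formula[OF ext] by (intro exI[of _ \<alpha>c] exI[of _ Vc]) simp
  qed
qed

end

section \<open>The helix\<close>

lemma sinh_of_real: "sinh (of_real x :: complex) = of_real (sinh x)"
  and cosh_of_real: "cosh (of_real x :: complex) = of_real (cosh x)"
  by (simp_all add: sinh_field_def cosh_field_def exp_of_real flip: of_real_minus)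

lemma sinh_Complex: "sinh (Complex u v) = Complex (sinh u * cos v) (cosh u * sin v)"
  and cosh_Complex: "cosh (Complex u v) = Complex (cosh u * cos v) (sinh u * sin v)"
proof -
  have i: "sinh (\<i> * of_real v) = \<i> * of_real (sin v)" "cosh (\<i> * of_real v) = of_real (cos v)"
    using sin_conv_sinh[of "of_real v"] cos_conv_cosh[of "of_real v"]
    by (simp_all add: sin_of_real cos_of_real)
  show "sinh (Complex u v) = Complex (sinh u * cos v) (cosh u * sin v)"
    "cosh (Complex u v) = Complex (cosh u * cos v) (sinh u * sin v)"
    unfolding Complex_eq by (simp_all add: sinh_add cosh_add i sinh_of_real cosh_of_real)
qed

section \<open>Holomorphic extensions of the helix data\<close>

definition helix_ext :: "real \<Rightarrow> complex \<Rightarrow> complex^3" where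
  "helix_ext lam z = vector [of_real lam * z, sinh z, cosh z]"

definition helix_field_ext :: "real \<Rightarrow> real \<Rightarrow> real \<Rightarrow> complex \<Rightarrow> complex^3" where
  "helix_field_ext a lam mu z = vector
     [sinh (of_real a * z) / of_real mu,
      cosh (of_real a * z) * sinh z - of_real lam * sinh (of_real a * z) * cosh z / of_real mu,
      cosh (of_real a * z) * cosh z - of_real lam * sinh (of_real a * z) * sinh z / of_real mu]"

lemma holomorphic_on_sinh [holomorphic_intros]:
  "f holomorphic_on A \<Longrightarrow> (\<lambda>z. sinh (f z)) holomorphic_on A"
  and holomorphic_on_cosh [holomorphic_intros]:
  "f holomorphic_on A \<Longrightarrow> (\<lambda>z. cosh (f z)) holomorphic_on A"
  unfolding sinh_field_def cosh_field_def by (auto intro!: holomorphic_intros)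

lemma holomorphic_extension_helix:
  "holomorphic_extension UNIV (helix lam) D (helix_ext lam)"
  unfolding holomorphic_extension_def forall_3 helix_ext_def helix_def vector_3
  by (auto simp: sinh_of_real cosh_of_real intro!: holomorphic_intros)

lemma holomorphic_extension_helix_field:
  assumes "mu \<noteq> 0"
  shows "holomorphic_extension UNIV (helix_field a lam mu) D (helix_field_ext a lam mu)"
  unfolding holomorphic_extension_def forall_3 helix_field_ext_def vector_3
proof (intro conjI ballI)
  fix t :: real
  have [simp]: "sinh (complex_of_real a * complex_of_real t) = of_real (sinh (a * t))"
    "cosh (complex_of_real a * complex_of_real t) = of_real (cosh (a * t))"
    by (simp_all flip: of_real_mult add: sinh_of_real cosh_of_real)
  show "sinh (of_real a * of_real t) / of_real mu = complex_of_real (helix_field a lam mu t $ 1)"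
    "cosh (of_real a * of_real t) * sinh (of_real t) - of_real lam * sinh (of_real a * of_real t) * cosh (of_real t) / of_real mu
      = complex_of_real (helix_field a lam mu t $ 2)"
    "cosh (of_real a * of_real t) * cosh (of_real t) - of_real lam * sinh (of_real a * of_real t) * sinh (of_real t) / of_real mu
      = complex_of_real (helix_field a lam mu t $ 3)"
    by (simp_all add: helix_field_def helix_n_def helix_b_def sinh_of_real cosh_of_real)
qed (use assms in \<open>auto intro!: holomorphic_intros\<close>)

lemma vderiv_helix_ext: "vderiv (helix_ext lam) z = vector [of_real lam, cosh z, sinh z]"
  by (auto simp: vec3_eq_iff helix_ext_def intro!: DERIV_imp_deriv derivative_eq_intros)

lemma vector_derivative_helix: "vector_derivative (helix lam) (at t) = vector [lam, cosh t, sinh t]"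
proof -
  have "complex_of_real (vector_derivative (helix lam) (at t) $ k) = vderiv (helix_ext lam) (of_real t) $ k" for k
    using holomorphic_extension_has_vector_derivative(2)[OF holomorphic_extension_helix[of lam UNIV]]
    by simp
  then have "complex_of_real (vector_derivative (helix lam) (at t) $ k) = vector [of_real lam, cosh (of_real t), sinh (of_real t)] $ k" for k
    by (simp only: vderiv_helix_ext)
  from this[of 1] this[of 2] this[of 3] show ?thesis
    by (simp add: vec3_eq_iff sinh_of_real cosh_of_real)
qed

text \<open>The vectors n (unit timelike) and b (unit spacelike) are orthogonal to each other and to
  alpha', so V is a hyperbolic rotation of n in the normal plane, and (alpha',alpha') = lam^2 +
  1.\<close>

lemma bjorling_data_helix:
  assumes mu: "mu = sqrt (lam\<^sup>2 + 1)"
  shows "bjorling_data UNIV (helix lam) (helix_field a lam mu)"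
proof -
  have mu0: "mu > 0" using mu by (simp add: add_nonneg_pos)
  have mu2: "mu\<^sup>2 = lam\<^sup>2 + 1" using mu by simp
  have "linner (vector [lam, cosh t, sinh t]) (vector [lam, cosh t, sinh t]) > 0" for t
    using cosh_square_eq[of t] by (simp add: linner_def power2_eq_square add_nonneg_pos)
  moreover have "linner (helix_field a lam mu t) (helix_field a lam mu t) = -1" for t
  proof -
    let ?s = "sinh (a * t)" and ?c = "cosh (a * t)"
    have "linner (helix_field a lam mu t) (helix_field a lam mu t)
        = (?s / mu)\<^sup>2 - (?c\<^sup>2 - (lam * ?s / mu)\<^sup>2) * ((cosh t)\<^sup>2 - (sinh t)\<^sup>2)"
      by (simp add: linner_def helix_field_def helix_n_def helix_b_def power2_eq_square algebra_simps diff_divide_distrib)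
    also have "\<dots> = ?s\<^sup>2 * ((lam\<^sup>2 + 1) / mu\<^sup>2) - ?c\<^sup>2"
      by (simp only: hyperbolic_pythagoras) (simp add: power_mult_distrib power_divide add_divide_distrib algebra_simps)
    also have "\<dots> = -1"
      using mu0 by (simp flip: mu2 add: cosh_square_eq)
    finally show ?thesis .
  qed
  moreover have "linner (helix_field a lam mu t) (vector [lam, cosh t, sinh t]) = 0" for t
  proof -
    have "linner (helix_field a lam mu t) (vector [lam, cosh t, sinh t])
        = lam * sinh (a * t) / mu * (1 - ((cosh t)\<^sup>2 - (sinh t)\<^sup>2))"
      by (simp add: linner_def helix_field_def helix_n_def helix_b_def power2_eq_square algebra_simps add_divide_distrib)
    then show ?thesis by (simp add: hyperbolic_pythagoras)
  qed
  ultimately show ?thesis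
    using real_analytic_on_entire_extension[OF holomorphic_extension_helix]
      real_analytic_on_entire_extension[OF holomorphic_extension_helix_field] mu0
    by (simp add: bjorling_data_def Let_def vector_derivative_helix is_interval_univ)
qed

section \<open>The cross product along the helix and its primitive\<close>

lemma lcross_helix_ext:
  assumes mu: "mu = sqrt (lam\<^sup>2 + 1)"
  shows "lcross (helix_field_ext a lam mu z) (vderiv (helix_ext lam) z) = vector
    [- cosh (of_real a * z),
     of_real lam * cosh (of_real a * z) * cosh z - of_real mu * sinh (of_real a * z) * sinh z,
     of_real lam * cosh (of_real a * z) * sinh z - of_real mu * sinh (of_real a * z) * cosh z]"
proof -
  let ?s = "sinh (complex_of_real a * z)" and ?c = "cosh (complex_of_real a * z)"
  let ?l = "complex_of_real lam" and ?m = "complex_of_real mu"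
  have "mu > 0" using mu by (simp add: add_nonneg_pos)
  moreover have "?l\<^sup>2 + 1 = ?m\<^sup>2"
    using mu by (simp flip: of_real_power)
  \<comment> \<open>This collapses the coefficients left by the factor 1/mu of b to the single
    constant mu.\<close>
  ultimately have m: "(?l\<^sup>2 + 1) / ?m = ?m"
    by (simp add: power2_eq_square)
  have "(?c * sinh z - ?l * ?s * cosh z / ?m) * sinh z - (?c * cosh z - ?l * ?s * sinh z / ?m) * cosh z
      = - ?c * ((cosh z)\<^sup>2 - (sinh z)\<^sup>2)"
    by (simp add: power2_eq_square algebra_simps)
  moreover have "(?c * cosh z - ?l * ?s * sinh z / ?m) * ?l - ?s / ?m * sinh z
      = ?l * ?c * cosh z - (?l\<^sup>2 + 1) / ?m * ?s * sinh z"
    by (simp add: power2_eq_square algebra_simps add_divide_distrib)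
  moreover have "- (?s / ?m * cosh z - (?c * sinh z - ?l * ?s * cosh z / ?m) * ?l)
      = ?l * ?c * sinh z - (?l\<^sup>2 + 1) / ?m * ?s * cosh z"
    by (simp add: power2_eq_square algebra_simps add_divide_distrib)
  ultimately show ?thesis
    unfolding vec3_eq_iff lcross_nth vderiv_helix_ext helix_field_ext_def vector_3 hyperbolic_pythagoras m
    by simp
qed

lemma bjorling_extension_helix:
  assumes mu: "mu = sqrt (lam\<^sup>2 + 1)" and D: "open D" "connected D" "range of_real \<subseteq> D"
    and W: "\<And>z k. ((\<lambda>z. W z $ k) has_field_derivative vector
      [- cosh (of_real a * z),
       of_real lam * cosh (of_real a * z) * cosh z - of_real mu * sinh (of_real a * z) * sinh z,
       of_real lam * cosh (of_real a * z) * sinh z - of_real mu * sinh (of_real a * z) * cosh z] $ k) (at z)"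
    and W_real: "\<And>t k. W (of_real t) $ k \<in> \<real>"
  shows "bjorling_extension UNIV (helix lam) (helix_field a lam mu) D (helix_ext lam) (helix_field_ext a lam mu) W"
proof
  have "mu > 0" using mu by (simp add: add_nonneg_pos)
  then show "holomorphic_extension UNIV (helix_field a lam mu) D (helix_field_ext a lam mu)"
    by (intro holomorphic_extension_helix_field) simp
  show "((\<lambda>z. W z $ k) has_field_derivative
      lcross (helix_field_ext a lam mu z) (vderiv (helix_ext lam) z) $ k) (at z)" for z k
    unfolding lcross_helix_ext[OF mu] by (rule W)
qed (use D W_real in \<open>simp_all add: bjorling_data_helix[OF mu] holomorphic_extension_helix\<close>)

text \<open>For a different from 1, the ansatz P sinh(az) cosh z + Q cosh(az) sinh z in the second
  component, and its analogue in the third, lead to a P + Q = lam and P + a Q = - mu, of determinant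
  a^2 - 1. At the resonance a = 1 the double-angle formulas apply, and the constant term (lam +
  mu)/2 of the second integrand integrates to a linear one.\<close>

definition helix_primitive :: "real \<Rightarrow> real \<Rightarrow> real \<Rightarrow> complex \<Rightarrow> complex^3" where
  "helix_primitive a lam mu z =
    (if a = 1 then vector
      [- sinh z,
       of_real ((lam + mu) / 2) * z + of_real ((lam - mu) / 2) * (sinh z * cosh z),
       of_real ((lam - mu) / 2) * (sinh z)\<^sup>2]
     else vector
      [- sinh (of_real a * z) / of_real a,
       (of_real (a * lam + mu) * (sinh (of_real a * z) * cosh z)
         - of_real (a * mu + lam) * (cosh (of_real a * z) * sinh z)) / of_real (a\<^sup>2 - 1),
       (of_real (a * lam + mu) * (sinh (of_real a * z) * sinh z)
         - of_real (a * mu + lam) * (cosh (of_real a * z) * cosh z)) / of_real (a\<^sup>2 - 1)])"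

lemma helix_primitive_real: "helix_primitive a lam mu (of_real t) $ k \<in> \<real>"
proof -
  have [simp]: "sinh (complex_of_real a * complex_of_real t) = of_real (sinh (a * t))"
    "cosh (complex_of_real a * complex_of_real t) = of_real (cosh (a * t))"
    by (simp_all flip: of_real_mult add: sinh_of_real cosh_of_real)
  show ?thesis
    using exhaust_3[of k] unfolding helix_primitive_def
    by (auto simp: sinh_of_real cosh_of_real simp del: of_real_add of_real_diff of_real_divide of_real_mult
        intro!: Reals_add Reals_mult Reals_diff Reals_divide Reals_power Reals_minus)
qed

lemma helix_primitive_has_field_derivative:
  assumes a: "a > 0"
  shows "((\<lambda>z. helix_primitive a lam mu z $ k) has_field_derivative vector
      [- cosh (of_real a * z),
       of_real lam * cosh (of_real a * z) * cosh z - of_real mu * sinh (of_real a * z) * sinh z,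
       of_real lam * cosh (of_real a * z) * sinh z - of_real mu * sinh (of_real a * z) * cosh z] $ k) (at z)"
proof (cases "a = 1")
  case True
  have cc: "cosh z * cosh z = sinh z * sinh z + 1"
    using cosh_square_eq[of z] by (simp add: power2_eq_square)
  have 1: "((\<lambda>z. - sinh z) has_field_derivative - cosh z) (at z)"
    by (auto intro!: derivative_eq_intros)
  have 2: "((\<lambda>z. of_real ((lam + mu) / 2) * z + of_real ((lam - mu) / 2) * (sinh z * cosh z))
      has_field_derivative of_real lam * cosh z * cosh z - of_real mu * sinh z * sinh z) (at z)"
    by (rule derivative_eq_intros refl)+ (simp add: field_simps cc)
  have 3: "((\<lambda>z. of_real ((lam - mu) / 2) * (sinh z)\<^sup>2)
      has_field_derivative of_real lam * cosh z * sinh z - of_real mu * sinh z * cosh z) (at z)"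
    by (rule derivative_eq_intros refl)+ (simp add: field_simps)
  show ?thesis
    using exhaust_3[of k] 1 2 3 True unfolding helix_primitive_def by auto
next
  case False
  define d where "d = complex_of_real (a\<^sup>2 - 1)"
  let ?a = "complex_of_real a"
  \<comment> \<open>Positivity of a excludes the root -1 of a^2 = 1, the case distinction the root
    1.\<close>
  have d: "d = ?a * ?a - 1" and d0: "d \<noteq> 0"
    using False a unfolding d_def of_real_eq_0_iff by (simp_all add: power2_eq_1_iff power2_eq_square[of ?a])
  have 1: "((\<lambda>z. - sinh (?a * z) / ?a) has_field_derivative - cosh (?a * z)) (at z)"
    using a by (auto intro!: derivative_eq_intros)
  \<comment> \<open>Differentiating without the denominator yields d times the integrand; the factor
    is divided out afterwards.\<close>
  have "((\<lambda>z. of_real (a * lam + mu) * (sinh (?a * z) * cosh z) - of_real (a * mu + lam) * (cosh (?a * z) * sinh z))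
      has_field_derivative d * (of_real lam * cosh (?a * z) * cosh z - of_real mu * sinh (?a * z) * sinh z)) (at z)"
    by (rule derivative_eq_intros refl)+ (simp add: d algebra_simps)
  from DERIV_cdivide[OF this, of d]
  have 2: "((\<lambda>z. (of_real (a * lam + mu) * (sinh (?a * z) * cosh z)
         - of_real (a * mu + lam) * (cosh (?a * z) * sinh z)) / d)
      has_field_derivative of_real lam * cosh (?a * z) * cosh z - of_real mu * sinh (?a * z) * sinh z) (at z)"
    using d0 by simp
  have "((\<lambda>z. of_real (a * lam + mu) * (sinh (?a * z) * sinh z) - of_real (a * mu + lam) * (cosh (?a * z) * cosh z))
      has_field_derivative d * (of_real lam * cosh (?a * z) * sinh z - of_real mu * sinh (?a * z) * cosh z)) (at z)"
    by (rule derivative_eq_intros refl)+ (simp add: d algebra_simps)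
  from DERIV_cdivide[OF this, of d]
  have 3: "((\<lambda>z. (of_real (a * lam + mu) * (sinh (?a * z) * sinh z)
         - of_real (a * mu + lam) * (cosh (?a * z) * cosh z)) / d)
      has_field_derivative of_real lam * cosh (?a * z) * sinh z - of_real mu * sinh (?a * z) * cosh z) (at z)"
    using d0 by simp
  show ?thesis
    using exhaust_3[of k] 1 2 3 False unfolding helix_primitive_def d_def by auto
qed

section \<open>Coordinates of the surface\<close>

lemma Re_helix_curve:
  fixes a lam mu :: real
  assumes a: "a > 0" "a \<noteq> 1"
  shows "(\<chi> k. Re (helix_ext lam (Complex u v) $ k + \<i> * helix_primitive a lam mu (Complex u v) $ k)) =
        vector [
          cosh (a * u) * sin (a * v) / a + lam * u,
          sinh u * ((a\<^sup>2 - 1) * cos v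
              + sinh (a * u) * ((a*mu + lam) * cos v * sin (a * v) - (a*lam + mu) * sin v * cos (a * v))) / (a\<^sup>2 - 1)
            + cosh u * cosh (a * u)
              * ((a*mu + lam) * sin v * cos (a * v) - (a*lam + mu) * cos v * sin (a * v)) / (a\<^sup>2 - 1),
          cosh u * ((a\<^sup>2 - 1) * cos v
              + sinh (a * u) * ((a*mu + lam) * cos v * sin (a * v) - (a*lam + mu) * sin v * cos (a * v))) / (a\<^sup>2 - 1)
            + sinh u * cosh (a * u)
              * ((a*mu + lam) * sin v * cos (a * v) - (a*lam + mu) * cos v * sin (a * v)) / (a\<^sup>2 - 1)]"
proof -
  have az: "of_real a * Complex u v = Complex (a * u) (a * v)"
    by (simp add: complex_eq_iff)
  \<comment> \<open>The denominator becomes one nonzero symbol, so that clearing it does not expand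
    a^2 - 1.\<close>
  define d where "d = a\<^sup>2 - 1"
  have "d \<noteq> 0" using a by (simp add: d_def power2_eq_1_iff)
  then show ?thesis
    using a unfolding d_def[symmetric]
    by (simp add: vec3_eq_iff helix_ext_def helix_primitive_def sinh_Complex cosh_Complex az
        Im_divide_of_real d_def[symmetric] field_simps del: of_real_add of_real_mult of_real_diff)
qed

text \<open>The real part of i W is - Im W; the linear term of the primitive thus produces the
  non-periodic summand -(mu + lam) v / 2.\<close>

lemma Re_helix_curve_1:
  fixes lam mu :: real
  shows "(\<chi> k. Re (helix_ext lam (Complex u v) $ k + \<i> * helix_primitive 1 lam mu (Complex u v) $ k)) =
        vector [
          lam * u + cosh u * sin v,
          1/2 * ((mu - lam) * ((sinh u)\<^sup>2 + (cosh u)\<^sup>2) * sin v * cos v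
            + 2 * sinh u * cos v - (mu + lam) * v),
          cosh u * cos v * ((mu - lam) * sinh u * sin v + 1)]"
  using sin_cos_squared_add[of v]
  by (simp add: vec3_eq_iff helix_ext_def helix_primitive_def sinh_Complex cosh_Complex
      power2_eq_square field_simps del: of_real_add of_real_mult of_real_diff)

theorem mainTheorem5:
  fixes a lam mu u0 :: real and D :: "complex set" and X :: "complex \<Rightarrow> real^3"
  assumes "a > 0" and "lam > 0" and "mu = sqrt (lam\<^sup>2 + 1)"
    and "open D" and "simply_connected D" and "range complex_of_real \<subseteq> D"
  shows "bjorling_data UNIV (helix lam) (helix_field a lam mu) \<and>
    (bjorling_surface UNIV (helix lam) (helix_field a lam mu) u0 D X \<longrightarrow>
      solves_bjorling_problem UNIV (helix lam) (helix_field a lam mu) D X) \<and>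
    (a \<noteq> 1 \<longrightarrow>
      (bjorling_surface UNIV (helix lam) (helix_field a lam mu) u0 D X \<longleftrightarrow>
        (\<forall>u v. Complex u v \<in> D \<longrightarrow> X (Complex u v) = vector [
          cosh (a * u) * sin (a * v) / a + lam * u,
          sinh u * ((a\<^sup>2 - 1) * cos v
              + sinh (a * u) * ((a*mu + lam) * cos v * sin (a * v) - (a*lam + mu) * sin v * cos (a * v))) / (a\<^sup>2 - 1)
            + cosh u * cosh (a * u)
              * ((a*mu + lam) * sin v * cos (a * v) - (a*lam + mu) * cos v * sin (a * v)) / (a\<^sup>2 - 1),
          cosh u * ((a\<^sup>2 - 1) * cos v
              + sinh (a * u) * ((a*mu + lam) * cos v * sin (a * v) - (a*lam + mu) * sin v * cos (a * v))) / (a\<^sup>2 - 1)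
            + sinh u * cosh (a * u)
              * ((a*mu + lam) * sin v * cos (a * v) - (a*lam + mu) * cos v * sin (a * v)) / (a\<^sup>2 - 1)]))) \<and>
    (a = 1 \<longrightarrow>
      (bjorling_surface UNIV (helix lam) (helix_field a lam mu) u0 D X \<longleftrightarrow>
        (\<forall>u v. Complex u v \<in> D \<longrightarrow> X (Complex u v) = vector [
          lam * u + cosh u * sin v,
          1/2 * ((mu - lam) * ((sinh u)\<^sup>2 + (cosh u)\<^sup>2) * sin v * cos v
            + 2 * sinh u * cos v - (mu + lam) * v),
          cosh u * cos v * ((mu - lam) * sinh u * sin v + 1)])))"
proof -
  have "connected D" using assms(5) by (rule simply_connected_imp_connected)
  then interpret bjorling_extension UNIV "helix lam" "helix_field a lam mu" D "helix_ext lam"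
    "helix_field_ext a lam mu" "helix_primitive a lam mu"
    using assms helix_primitive_has_field_derivative helix_primitive_real
    by (intro bjorling_extension_helix) auto
  \<comment> \<open>The interval is the whole line, so any u0 is admissible; points of
    \<open>D\<close> are split into their coordinates u and v.\<close>
  have curve: "bjorling_surface UNIV (helix lam) (helix_field a lam mu) u0 D X \<longleftrightarrow>
      (\<forall>u v. Complex u v \<in> D \<longrightarrow> X (Complex u v) =
        (\<chi> k. Re (helix_ext lam (Complex u v) $ k + \<i> * helix_primitive a lam mu (Complex u v) $ k)))"
    unfolding bjorling_surface_iff[OF UNIV_I] weierstrass_curve_def vec_lambda_beta
    by (metis complex.collapse)
  have "solves_bjorling_problem UNIV (helix lam) (helix_field a lam mu) D X"
    if "bjorling_surface UNIV (helix lam) (helix_field a lam mu) u0 D X"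
    using that bjorling_surface_iff[OF UNIV_I] by (intro solves_bjorling_problem_Re_curve) blast
  then show ?thesis
    unfolding curve using data Re_helix_curve[OF assms(1)] Re_helix_curve_1 by simp
qed

end
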